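(* With $t_j$ as defined in the context, for every real $x$, $$\sin\pi x=\sum_{j=1}^\infty t_j\,\pi^{2j}\,(x(1-x))^j .$$ Also, for each integer $m\ge 1$ let $$Q_m(x):=\sum_{j=1}^m t_j\,\pi^{2j}(x(1-x))^j,\qquad q_m:=\frac{\pi^2/4}{(2m+4)(2m+3)}.$$ Then for all integers $m\ge1$ and all $x\in(0,1)$, $$Q_m(x)<Q_{m+1}(x)<\sin\pi x$$ and $$0<\sin\pi x-Q_m(x)<\frac{\pi^{2m+2}(x(1-x))^{m+1}}{(2m+2)!}\,\frac{1}{1-q_m},$$ and, for all $x\in(0,1)$, as $m\to\infty$, $$\frac{\pi^{2m+2}(x(1-x))^{m+1}}{(2m+2)!}\,\frac{1}{1-q_m}\ \sim\ \frac{\pi^{2m+2}(x(1-x))^{m+1}}{(2m+2)!}$$ (i.e. the ratio of the two sides tends to $1$).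
   Context: For integers $j\ge 1$, $$t_j:=\sum_{k=0}^\infty \frac{(-\pi^2/4)^k}{(2j+2k)!}\binom{j+k}{j}.$$ *)

theory Defs
  imports Complex_Main "HOL-Library.Landau_Symbols"
begin

definition t_coeff :: "nat \<Rightarrow> real" where
  "t_coeff j = (\<Sum>k. (- (pi\<^sup>2) / 4) ^ k / fact (2 * j + 2 * k) * real ((j + k) choose j))"

definition Q_poly :: "nat \<Rightarrow> real \<Rightarrow> real" where
  "Q_poly m x = (\<Sum>j = 1..m. t_coeff j * pi ^ (2 * j) * (x * (1 - x)) ^ j)"

definition q_ratio :: "nat \<Rightarrow> real" where
  "q_ratio m = (pi\<^sup>2 / 4) / ((2 * real m + 4) * (2 * real m + 3))"

end

theory Submission
  imports Defs "HOL-Analysis.Infinite_Sum" "HOL-Real_Asymp.Real_Asymp"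
begin

text \<open>
  With \<open>w = x (1 - x)\<close> one has \<open>(x - 1/2)\<^sup>2 = 1/4 - w\<close>, so
  \<open>sin (\<pi> x) = cos (\<pi> (x - 1/2)) = (\<Sum>n. (\<pi>\<^sup>2 w - \<pi>\<^sup>2/4) ^ n / (2 n)!)\<close>. Expanding each power
  binomially and interchanging the sums gives \<open>\<Sum>j. t_j (\<pi>\<^sup>2 w) ^ j\<close>, and
  \<open>t_0 = cos (\<pi>/2) = 0\<close>. For \<open>j \<ge> 1\<close> the series \<open>t_j\<close> alternates with strictly decreasing terms,
  so \<open>0 < t_j < 1 / (2 j)!\<close>; since \<open>w \<le> 1/4\<close>, the remainder is dominated by a geometric series
  of ratio \<open>q_m\<close>.
\<close>

section \<open>Re-expansion of a power series about a shifted centre\<close>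

text \<open>Fubini on the triangle of pairs \<open>(n, j)\<close> with \<open>j \<le> n\<close>: by
  the binomial theorem the hypothesis says exactly that the row sums of the absolute values are
  summable. This licenses summing by rows, which gives the powers of \<open>a + b\<close>, or by
  columns, which gives the powers of \<open>b\<close>.\<close>

lemma powser_recenter:
  fixes c :: "nat \<Rightarrow> real" and a b :: real
  assumes "summable (\<lambda>n. \<bar>c n\<bar> * (\<bar>a\<bar> + \<bar>b\<bar>) ^ n)"
  shows "summable (\<lambda>k. c (j + k) * real ((j + k) choose j) * a ^ k * b ^ j)"
    and "(\<lambda>j. \<Sum>k. c (j + k) * real ((j + k) choose j) * a ^ k * b ^ j) sums (\<Sum>n. c n * (a + b) ^ n)"
proof -
  define S where "S = (SIGMA n:UNIV. {..n::nat})"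
  define g where "g = (\<lambda>(n, j). c n * real (n choose j) * a ^ (n - j) * b ^ j)"
  \<comment> \<open>The summands are commuted first because \<open>binomial_ring\<close> puts the
    summation index on the first one, and \<open>g\<close> has \<open>j\<close> as the exponent of
    \<open>b\<close>.\<close>
  have norm_sum: "(\<Sum>j\<le>n. norm (g (n, j))) = \<bar>c n\<bar> * (\<bar>a\<bar> + \<bar>b\<bar>) ^ n" for n
    unfolding add.commute[of "\<bar>a\<bar>"] binomial_ring
    by (simp add: g_def abs_mult power_abs sum_distrib_left mult_ac)
  have row: "(\<Sum>j\<le>n. g (n, j)) = c n * (a + b) ^ n" for n
    unfolding add.commute[of a] binomial_ring
    by (simp add: g_def sum_distrib_left mult_ac)
  have "(\<lambda>n. \<bar>c n\<bar> * (\<bar>a\<bar> + \<bar>b\<bar>) ^ n) summable_on UNIV"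
    using assms by (subst summable_on_UNIV_nonneg_real_iff) auto
  then have "g abs_summable_on S"
    unfolding S_def abs_summable_on_Sigma_iff by (simp add: norm_sum[simplified] abs_mult power_abs)
  then have "g summable_on S"
    by (rule abs_summable_summable)
  then obtain V where V: "(g has_sum V) S"
    by (auto simp: summable_on_def)
  have "((\<lambda>n. c n * (a + b) ^ n) has_sum V) UNIV"
    using V unfolding S_def
    by (rule has_sum_Sigma') (simp add: has_sum_finiteI row)
  then have V_eq: "V = (\<Sum>n. c n * (a + b) ^ n)"
    using has_sum_imp_sums sums_unique by blast
  \<comment> \<open>Substituting \<open>k = n - j\<close> straightens the triangle into a full
    quadrant, where both orders of summation are unrestricted.\<close>
  have bij: "bij_betw (\<lambda>(j, k). (j + k, j)) (UNIV \<times> UNIV) S"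
    by (rule bij_betwI[where g = "\<lambda>(n, j). (j, n - j)"]) (auto simp: S_def)
  have "((\<lambda>p. g ((\<lambda>(j, k). (j + k, j)) p)) has_sum V) (UNIV \<times> UNIV)"
    using V by (subst has_sum_reindex_bij_betw[OF bij])
  then have pairs: "((\<lambda>(j, k). c (j + k) * real ((j + k) choose j) * a ^ k * b ^ j) has_sum V) (UNIV \<times> UNIV)"
    by (simp add: g_def case_prod_unfold)
  then have "(\<lambda>(j, k). c (j + k) * real ((j + k) choose j) * a ^ k * b ^ j) summable_on UNIV \<times> UNIV"
    by (auto simp: summable_on_def)
  from summable_on_SigmaD1[OF this]
  have col: "(\<lambda>k. c (j + k) * real ((j + k) choose j) * a ^ k * b ^ j) summable_on UNIV" for j
    by simp
  then show "summable (\<lambda>k. c (j + k) * real ((j + k) choose j) * a ^ k * b ^ j)"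
    by (rule summable_on_imp_summable)
  have "((\<lambda>j. \<Sum>k. c (j + k) * real ((j + k) choose j) * a ^ k * b ^ j) has_sum V) UNIV"
  proof (rule has_sum_Sigma'[OF pairs])
    fix j
    obtain s where s: "((\<lambda>k. c (j + k) * real ((j + k) choose j) * a ^ k * b ^ j) has_sum s) UNIV"
      using col[of j] by (auto simp: summable_on_def)
    moreover have "s = (\<Sum>k. c (j + k) * real ((j + k) choose j) * a ^ k * b ^ j)"
      using has_sum_imp_sums[OF s] by (rule sums_unique)
    ultimately show "((\<lambda>k. case (j, k) of (j, k) \<Rightarrow> c (j + k) * real ((j + k) choose j) * a ^ k * b ^ j)
        has_sum (\<Sum>k. c (j + k) * real ((j + k) choose j) * a ^ k * b ^ j)) UNIV"
      by simp
  qed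
  then show "(\<lambda>j. \<Sum>k. c (j + k) * real ((j + k) choose j) * a ^ k * b ^ j) sums (\<Sum>n. c n * (a + b) ^ n)"
    unfolding V_eq by (rule has_sum_imp_sums)
qed

section \<open>The cosine series and the expansion of sin(pi x)\<close>

text \<open>Since the odd coefficients vanish, the cosine is a power series in
  \<open>- y\<^sup>2\<close>; this is the variable that is later split as
  \<open>a + b\<close>.\<close>

lemma cos_eq_even_powser: "(\<lambda>n. (- (y\<^sup>2)) ^ n / fact (2 * n)) sums cos (y :: real)"
proof -
  have "(\<lambda>n. cos_coeff n * y ^ n) sums cos y"
    using cos_converges[of y] by simp
  moreover have "strict_mono (\<lambda>n::nat. 2 * n)"
    by (simp add: strict_mono_def)
  moreover have "cos_coeff n * y ^ n = 0" if "n \<notin> range (\<lambda>n::nat. 2 * n)" for n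
    using that by (auto simp: cos_coeff_def elim!: evenE)
  ultimately have "(\<lambda>n. cos_coeff (2 * n) * y ^ (2 * n)) sums cos y"
    by (subst sums_mono_reindex) auto
  then show ?thesis
    by (simp add: cos_coeff_def power_mult power_minus[of "y\<^sup>2"])
qed

text \<open>Comparison with the exponential series. The absolute value is kept so that the statement
  matches the hypothesis of \<open>powser_recenter\<close> for
  \<open>c n = 1 / fact (2 * n)\<close>.\<close>

lemma summable_power_div_fact_double:
  fixes r :: real
  assumes "0 \<le> r"
  shows "summable (\<lambda>n. \<bar>1 / fact (2 * n)\<bar> * r ^ n)"
proof (rule summable_comparison_test')
  show "summable (\<lambda>n. inverse (fact n) * r ^ n)"
    by (rule summable_exp)
  show "norm (\<bar>1 / fact (2 * n)\<bar> * r ^ n) \<le> inverse (fact n) * r ^ n" if "n \<ge> 0" for n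
    using assms by (auto simp: abs_mult divide_simps intro!: mult_left_mono fact_mono)
qed

lemma summable_t_coeff:
  "summable (\<lambda>k. (- (pi\<^sup>2) / 4) ^ k / fact (2 * j + 2 * k) * real ((j + k) choose j))"
  \<comment> \<open>Taking \<open>b = 1\<close> removes the factor \<open>b ^ j\<close>.\<close>
  using powser_recenter(1)[OF summable_power_div_fact_double, of "- (pi\<^sup>2) / 4" 1 j]
  by (simp add: distrib_left mult_ac)

lemma t_coeff_0: "t_coeff 0 = 0"
proof -
  have "(\<lambda>k. (- (pi\<^sup>2) / 4) ^ k / fact (2 * k)) sums cos (pi / 2)"
    using cos_eq_even_powser[of "pi / 2"] by (simp add: power_divide)
  then show ?thesis
    by (simp add: t_coeff_def sums_iff)
qed

lemma sin_pi_sums_t_coeff: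
  "(\<lambda>j. t_coeff (Suc j) * pi ^ (2 * Suc j) * (x * (1 - x)) ^ Suc j) sums sin (pi * x)"
proof -
  define a where "a = - (pi\<^sup>2) / 4"
  define b where "b = pi\<^sup>2 * (x * (1 - x))"
  have "sin (pi * x) = cos (pi * (x - 1 / 2))"
    by (simp add: cos_diff algebra_simps)
  moreover have "- ((pi * (x - 1 / 2))\<^sup>2) = a + b"
    by (simp add: a_def b_def power2_eq_square field_simps)
  ultimately have "(\<Sum>n. 1 / fact (2 * n) * (a + b) ^ n) = sin (pi * x)"
    using cos_eq_even_powser[of "pi * (x - 1 / 2)"] by (simp add: sums_iff)
  then have "(\<lambda>j. \<Sum>k. 1 / fact (2 * (j + k)) * real ((j + k) choose j) * a ^ k * b ^ j) sums sin (pi * x)"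
    using powser_recenter(2)[OF summable_power_div_fact_double, of a b] by simp
  moreover have "(\<Sum>k. 1 / fact (2 * (j + k)) * real ((j + k) choose j) * a ^ k * b ^ j) = t_coeff j * b ^ j" for j
    using suminf_mult2[OF summable_t_coeff[of j], of "b ^ j"]
    by (simp add: t_coeff_def a_def distrib_left mult_ac)
  ultimately have "(\<lambda>j. t_coeff j * b ^ j) sums sin (pi * x)"
    by simp
  \<comment> \<open>The series may start at index 1 because its constant term is
    \<open>t_coeff 0 = 0\<close>.\<close>
  then have "(\<lambda>j. t_coeff (Suc j) * b ^ Suc j) sums sin (pi * x)"
    by (subst sums_Suc_iff) (simp add: t_coeff_0)
  then show ?thesis
    by (simp only: b_def power_mult_distrib power_mult mult.assoc)
qed

section \<open>Size of the coefficients\<close>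

text \<open>A crude bound suffices: the denominators it is set against are at least 6 and
  12.\<close>

lemma pi_squared_quarter_less_4: "pi\<^sup>2 / 4 < 4"
  using power_strict_mono[OF pi_less_4, of 2] by simp

lemma t_coeff_bounds:
  assumes "1 \<le> j"
  shows "0 < t_coeff j" and "t_coeff j < 1 / fact (2 * j)"
proof -
  define a where "a = (\<lambda>k. (pi\<^sup>2 / 4) ^ k / fact (2 * j + 2 * k) * real ((j + k) choose j))"
  have pos: "0 < a k" for k
    by (simp add: a_def)
  have alt: "(- (pi\<^sup>2) / 4) ^ k / fact (2 * j + 2 * k) * real ((j + k) choose j) = (- 1) ^ k * a k" for k
    using power_minus[of "pi\<^sup>2 / 4" k] by (simp add: a_def)
  have dec: "a (Suc k) < a k" for k
  proof -
    have "Suc k * ((j + Suc k) choose Suc k) = Suc (j + k) * ((j + k) choose k)"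
      using Suc_times_binomial_eq[of "j + k" k] by (simp only: add_Suc_right mult.commute)
    moreover have "((j + i) choose i) = ((j + i) choose j)" for i
      using binomial_symmetric[of j "j + i"] by simp
    ultimately have "Suc k * ((j + Suc k) choose j) = Suc (j + k) * ((j + k) choose j)"
      by metis
    then have ch: "real ((j + Suc k) choose j) = real (Suc (j + k)) * real ((j + k) choose j) / real (Suc k)"
      by (metis nonzero_mult_div_cancel_left of_nat_0_eq_iff of_nat_mult nat.distinct(1))
    have "fact (2 * j + 2 * Suc k) =
        (2 * real (Suc (j + k))) * (2 * real j + 2 * real k + 1) * (fact (2 * j + 2 * k) :: real)"
      by (simp add: algebra_simps)
    \<comment> \<open>The factor \<open>Suc (j + k)\<close> from the binomial quotient cancels the
      one from the factorial quotient.\<close>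
    then have ratio: "a (Suc k) = a k * ((pi\<^sup>2 / 4) / (2 * real (Suc k) * (2 * real j + 2 * real k + 1)))"
      unfolding a_def ch by (simp add: divide_simps del: fact_Suc of_nat_Suc)
    \<comment> \<open>Here \<open>1 \<le> j\<close> is essential: for \<open>j = k = 0\<close> the
      product is 2, which is less than \<open>pi\<^sup>2 / 4\<close>.\<close>
    have "2 * 3 \<le> 2 * real (Suc k) * (2 * real j + 2 * real k + 1)"
      using assms by (intro mult_mono) auto
    then have "(pi\<^sup>2 / 4) / (2 * real (Suc k) * (2 * real j + 2 * real k + 1)) < 1"
      using pi_squared_quarter_less_4 by (simp add: divide_less_eq)
    then show ?thesis
      unfolding ratio using pos[of k] by (simp only: mult_less_cancel_left2) auto
  qed
  have sum: "summable (\<lambda>k. (- 1) ^ k * a k)"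
    using summable_t_coeff[of j] by (simp only: alt)
  have "(\<lambda>k. norm ((- 1) ^ k * a k)) \<longlonglongrightarrow> 0"
    using summable_LIMSEQ_zero[OF sum] by (rule tendsto_norm_zero)
  then have lim: "a \<longlonglongrightarrow> 0"
    using pos by (simp add: abs_mult less_imp_le)
  have t: "t_coeff j = (\<Sum>k. (- 1) ^ k * a k)"
    by (simp only: t_coeff_def alt)
  note leibniz = summable_Leibniz'[OF lim less_imp_le[OF pos] less_imp_le[OF dec]]
  have "a 0 - a 1 \<le> t_coeff j"
    using leibniz(2)[of 1] by (simp add: t numeral_2_eq_2)
  then show "0 < t_coeff j"
    using dec[of 0] by simp
  \<comment> \<open>The one-term partial sum would only give \<open>t_coeff j \<le> a 0\<close>; two
    more terms make the bound strict, since \<open>a 2 < a 1\<close>.\<close>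
  have "t_coeff j \<le> a 0 - a 1 + a 2"
    using leibniz(4)[of 1] by (simp add: t numeral_2_eq_2)
  then show "t_coeff j < 1 / fact (2 * j)"
    using dec[of 1] by (simp add: a_def numeral_2_eq_2)
qed

section \<open>Geometric control of the remainder\<close>

lemma q_ratio_bounds:
  shows "0 < q_ratio m" and "q_ratio m < 1"
proof -
  have "4 * 3 \<le> (2 * real m + 4) * (2 * real m + 3)"
    by (intro mult_mono) auto
  then show "0 < q_ratio m" "q_ratio m < 1"
    using pi_squared_quarter_less_4 by (auto simp: q_ratio_def divide_less_eq intro!: divide_pos_pos)
qed

lemma q_ratio_tendsto_0: "q_ratio \<longlonglongrightarrow> 0"
  unfolding q_ratio_def by real_asymp

text \<open>The quotient of consecutive terms is \<open>y / d\<close>. It is largest at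
  \<open>y = pi\<^sup>2 / 4\<close> and \<open>i = 0\<close>, where \<open>d = (2m+4)(2m+3)\<close>;
  that extreme value is \<open>q_ratio m\<close>.\<close>

lemma power_div_fact_double_le_geometric:
  assumes "0 \<le> y" "y \<le> pi\<^sup>2 / 4"
  shows "y ^ (i + Suc m) / fact (2 * (i + Suc m)) \<le> y ^ Suc m / fact (2 * Suc m) * q_ratio m ^ i"
proof (induction i)
  case (Suc i)
  define d where "d = (2 * real (i + Suc m) + 2) * (2 * real (i + Suc m) + 1)"
  have "y / d \<le> q_ratio m"
    unfolding q_ratio_def d_def using assms by (intro frac_le mult_mono) auto
  moreover have "fact (2 * (Suc i + Suc m)) = d * (fact (2 * (i + Suc m)) :: real)"
    by (simp add: d_def algebra_simps)
  then have "y ^ (Suc i + Suc m) / fact (2 * (Suc i + Suc m)) = y ^ (i + Suc m) / fact (2 * (i + Suc m)) * (y / d)"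
    by (simp only: power_Suc add_Suc times_divide_times_eq mult_ac)
  ultimately have "y ^ (Suc i + Suc m) / fact (2 * (Suc i + Suc m))
      \<le> (y ^ Suc m / fact (2 * Suc m) * q_ratio m ^ i) * q_ratio m"
    using assms Suc.IH by (simp only:) (intro mult_mono, auto simp: d_def q_ratio_def simp del: fact_Suc)
  then show ?case
    by (simp only: power_Suc mult_ac)
qed simp

lemma Q_poly_remainder_bounds:
  assumes "0 < x" "x < 1"
  shows "0 < sin (pi * x) - Q_poly m x"
    and "sin (pi * x) - Q_poly m x
      < pi ^ (2 * m + 2) * (x * (1 - x)) ^ (m + 1) / fact (2 * m + 2) * (1 / (1 - q_ratio m))"
proof -
  define y where "y = pi\<^sup>2 * (x * (1 - x))"
  define T where "T = (\<lambda>i. t_coeff (i + Suc m) * y ^ (i + Suc m))"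
  define G where "G = (\<lambda>i. y ^ Suc m / fact (2 * Suc m) * q_ratio m ^ i)"
  have y_pos: "0 < y"
    using assms by (simp add: y_def)
  \<comment> \<open>This is \<open>(x - 1/2)\<^sup>2 \<ge> 0\<close>.\<close>
  have "x * (1 - x) \<le> 1 / 4"
    using zero_le_power2[of "x - 1 / 2"] by (simp add: power2_eq_square algebra_simps)
  then have y_le: "y \<le> pi\<^sup>2 / 4"
    using mult_left_mono[of "x * (1 - x)" "1 / 4" "pi\<^sup>2"] by (simp add: y_def)
  have y_powers: "t_coeff j * pi ^ (2 * j) * (x * (1 - x)) ^ j = t_coeff j * y ^ j" for j
    by (simp only: y_def power_mult_distrib power_mult mult.assoc)
  have "(\<lambda>j. t_coeff (Suc j) * y ^ Suc j) sums sin (pi * x)"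
    using sin_pi_sums_t_coeff[of x] by (simp only: y_powers)
  moreover have "Q_poly m x = (\<Sum>j<m. t_coeff (Suc j) * y ^ Suc j)"
    unfolding Q_poly_def y_powers One_nat_def by (rule sum.atLeast1_atMost_eq)
  ultimately have T_sums: "T sums (sin (pi * x) - Q_poly m x)"
    using sums_split_initial_segment[of "\<lambda>j. t_coeff (Suc j) * y ^ Suc j" _ m] by (simp add: T_def)
  have T_pos: "0 < T i" for i
    using t_coeff_bounds(1)[of "i + Suc m"] y_pos by (simp add: T_def)
  show "0 < sin (pi * x) - Q_poly m x"
    using suminf_pos[of T] T_sums T_pos by (simp add: sums_iff)
  have T_less: "T i < G i" for i
  proof -
    have "T i < y ^ (i + Suc m) / fact (2 * (i + Suc m))"
      using mult_strict_right_mono[OF t_coeff_bounds(2)[of "i + Suc m"], of "y ^ (i + Suc m)"] y_pos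
      by (simp add: T_def del: fact_Suc)
    also have "\<dots> \<le> G i"
      unfolding G_def using y_pos y_le by (intro power_div_fact_double_le_geometric) auto
    finally show ?thesis .
  qed
  have G_sums: "G sums (y ^ Suc m / fact (2 * Suc m) * (1 / (1 - q_ratio m)))"
    unfolding G_def using q_ratio_bounds[of m] by (intro sums_mult geometric_sums) auto
  \<comment> \<open>Termwise strict inequality survives summation because \<open>G - T\<close> is a
    convergent series of positive terms.\<close>
  have "0 < (\<Sum>i. G i - T i)"
    using sums_diff[OF G_sums T_sums] T_less by (intro suminf_pos) (auto simp: sums_iff)
  then have "sin (pi * x) - Q_poly m x < y ^ Suc m / fact (2 * Suc m) * (1 / (1 - q_ratio m))"
    using sums_diff[OF G_sums T_sums] by (simp add: sums_iff)
  also have "y ^ Suc m = pi ^ (2 * m + 2) * (x * (1 - x)) ^ (m + 1)"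
    by (simp add: y_def power_mult_distrib power_mult power2_eq_square)
  finally show "sin (pi * x) - Q_poly m x
      < pi ^ (2 * m + 2) * (x * (1 - x)) ^ (m + 1) / fact (2 * m + 2) * (1 / (1 - q_ratio m))"
    by simp
qed

lemma Q_poly_strict_mono:
  assumes "0 < x" "x < 1"
  shows "Q_poly m x < Q_poly (m + 1) x"
  using t_coeff_bounds(1)[of "Suc m"] assms by (simp add: Q_poly_def)

theorem corollary1p5:
  shows "(\<forall>x::real. (\<lambda>j. t_coeff (Suc j) * pi ^ (2 * Suc j) * (x * (1 - x)) ^ Suc j) sums sin (pi * x))
    \<and> (\<forall>m\<ge>1. \<forall>x\<in>{0<..<1::real}.
          Q_poly m x < Q_poly (m + 1) x \<and> Q_poly (m + 1) x < sin (pi * x))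
    \<and> (\<forall>m\<ge>1. \<forall>x\<in>{0<..<1::real}.
          0 < sin (pi * x) - Q_poly m x \<and>
          sin (pi * x) - Q_poly m x
            < pi ^ (2 * m + 2) * (x * (1 - x)) ^ (m + 1) / fact (2 * m + 2) * (1 / (1 - q_ratio m)))
    \<and> (\<forall>x\<in>{0<..<1::real}.
          (\<lambda>m. pi ^ (2 * m + 2) * (x * (1 - x)) ^ (m + 1) / fact (2 * m + 2) * (1 / (1 - q_ratio m)))
            \<sim>[at_top] (\<lambda>m. pi ^ (2 * m + 2) * (x * (1 - x)) ^ (m + 1) / fact (2 * m + 2)))"
proof (intro conjI allI impI ballI)
  fix x :: real
  show "(\<lambda>j. t_coeff (Suc j) * pi ^ (2 * Suc j) * (x * (1 - x)) ^ Suc j) sums sin (pi * x)"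
    by (rule sin_pi_sums_t_coeff)
next
  fix m :: nat and x :: real
  assume "x \<in> {0<..<1}"
  then have x: "0 < x" "x < 1"
    by auto
  show "Q_poly m x < Q_poly (m + 1) x"
    using x by (rule Q_poly_strict_mono)
  \<comment> \<open>Positivity of the remainder, applied one index further.\<close>
  show "Q_poly (m + 1) x < sin (pi * x)"
    using Q_poly_remainder_bounds(1)[OF x, of "m + 1"] by simp
  show "0 < sin (pi * x) - Q_poly m x"
    using x by (rule Q_poly_remainder_bounds)
  show "sin (pi * x) - Q_poly m x
      < pi ^ (2 * m + 2) * (x * (1 - x)) ^ (m + 1) / fact (2 * m + 2) * (1 / (1 - q_ratio m))"
    using x by (rule Q_poly_remainder_bounds)
next
  fix x :: real
  \<comment> \<open>Both sides share their first factor, so only the correction factor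
    \<open>1 / (1 - q_ratio m)\<close> has to be shown equivalent to 1.\<close>
  have "(\<lambda>m. 1 / (1 - q_ratio m)) \<longlonglongrightarrow> 1 / (1 - 0)"
    by (intro tendsto_intros q_ratio_tendsto_0) simp
  then have "(\<lambda>m. 1 / (1 - q_ratio m)) \<sim>[at_top] (\<lambda>_. 1)"
    by (intro asymp_equivI') simp
  then have "(\<lambda>m. pi ^ (2 * m + 2) * (x * (1 - x)) ^ (m + 1) / fact (2 * m + 2) * (1 / (1 - q_ratio m)))
      \<sim>[at_top] (\<lambda>m. pi ^ (2 * m + 2) * (x * (1 - x)) ^ (m + 1) / fact (2 * m + 2) * 1)"
    by (intro asymp_equiv_mult asymp_equiv_refl)
  then show "(\<lambda>m. pi ^ (2 * m + 2) * (x * (1 - x)) ^ (m + 1) / fact (2 * m + 2) * (1 / (1 - q_ratio m)))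
      \<sim>[at_top] (\<lambda>m. pi ^ (2 * m + 2) * (x * (1 - x)) ^ (m + 1) / fact (2 * m + 2))"
    by simp
qed

end
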